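(* Let $\mathcal S=\{\phi_e\}_{e\in E}$ be a finite and irreducible conformal GDMS (graph directed Markov system) in $\mathbb R^n$ such that $$\operatorname{dist}(\partial X,J_{\mathcal S})>0 .$$ Then $J_{\mathcal S}$ is $v$-directed porous for every $v\in S^{n-1}$.
   Context: A GDMS $\mathcal S=\{V,E,A,t,i,\{X_v\}_{v\in V},\{\phi_e\}_{e\in E}\}$, abbreviated $\{\phi_e\}_{e\in E}$, consists of: a directed multigraph with a countable set of edges $E$ (the alphabet, having at least two elements) and a finite set of vertices $V$; an incidence matrix $A:E\times E\to\{0,1\}$; maps $i,t:E\to V$ with $t(a)=i(b)$ whenever $A_{ab}=1$; non-empty compact metric spaces $X_v$; injective contractions $\phi_e:X_{t(e)}\to X_{i(e)}$, all with Lipschitz constant at most a common $s\in(0,1)$. For every $v\in V$ there are $e,e'\in E$ with $t(e)=v$, $i(e')=v$. The GDMS is finite if $E$ is finite. $E_A^n$ is the set of words $\omega=\omega_1\ldots\omega_n$ with $A_{\omega_k\omega_{k+1}}=1$ for all $k<n$; $E_A^*=\bigcup_{n\ge0}E_A^n$; $E_A^{\mathbb N}$ is the set of infinite admissible words; $\omega|_n=\omega_1\ldots\omega_n$. For $\omega\in E_A^n$, $n\ge1$, $\phi_\omega=\phi_{\omega_1}\circ\cdots\circ\phi_{\omega_n}:X_{t(\omega)}\to X_{i(\omega)}$ with $t(\omega)=t(\omega_n)$, $i(\omega)=i(\omega_1)$. A finite GDMS is irreducible if for all $a,b\in E$ there is $\omega\in E_A^*$ with $a\omega b\in E_A^*$.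 $X=\bigcup_{v}X_v\subset\mathbb R^n$ (disjoint union), $\partial X$ is its topological boundary, $\pi(\omega)$ is the unique point of $\bigcap_n\phi_{\omega|_n}(X_{t(\omega_n)})$ for $\omega\in E_A^{\mathbb N}$, and $J_{\mathcal S}=\pi(E_A^{\mathbb N})$ is the limit set. The GDMS is conformal if (1) each $X_v$ is a compact connected subset of a fixed $\mathbb R^n$ with $X_v=\overline{\operatorname{Int}X_v}$; (2) (open set condition) $\phi_a(\operatorname{Int}X_{t(a)})\cap\phi_b(\operatorname{Int}X_{t(b)})=\emptyset$ for $a\ne b$ in $E$; (3) for each $v$ there is an open connected $W_v\supset X_v$ such that each $\phi_e$ with $t(e)=v$ extends to a $C^1$ conformal diffeomorphism of $W_v$ into $W_{i(e)}$ (conformal: the derivative at each point is a similarity). Standing assumptions: compact sets $S_v$ with $X_v\subset\operatorname{Int}S_v\subset S_v\subset W_v$ are fixed, pairwise disjoint; and bounded distortion holds: there are $\alpha>0$, $K\ge1$ with $\big|\|D\phi_\omega(p)\|/\|D\phi_\omega(q)\|-1\big|\le K|p-q|^\alpha$ and $K^{-1}\le\|D\phi_\omega(p)\|/\|D\phi_\omega(q)\|\le K$ for all $\omega\in E_A^*$, $p,q\in S_{t(\omega)}$. Directed porosity: for $v\in S^{n-1}$ let $l_v$ be the line through the origin and $v$. For a bounded $G\subset\mathbb R^n$, $x\in\mathbb R^n$, $r>0$, $\operatorname{por}_v(G,x,r)=\sup\{c\ge0:B(y,cr)\subset B(x,r)\setminus G\text{ for some }y\in x+l_v\}$. $G$ is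 $v$-directed porous if there are $c\in(0,1)$ and $r_0>0$ with $\operatorname{por}_v(G,x,r)\ge c$ for every $x\in G$ and $r\in(0,r_0)$. *)

theory Defs
  imports "HOL-Analysis.Analysis"
begin

section \<open>Graph directed Markov systems\<close>

text \<open>The map \<open>phi G e\<close> is a total function, of which only the restriction to
  \<open>piece G (ter G e)\<close> matters for a general system. The admissibility relation \<open>adm\<close> is the
  0-1 incidence matrix.\<close>

record ('v, 'e, 'a) gdms_data =
  verts :: "'v set"
  edges :: "'e set"
  adm   :: "'e \<Rightarrow> 'e \<Rightarrow> bool"
  ter   :: "'e \<Rightarrow> 'v"
  ini   :: "'e \<Rightarrow> 'v"
  piece :: "'v \<Rightarrow> 'a set"
  phi   :: "'e \<Rightarrow> 'a \<Rightarrow> 'a"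

locale gdms =
  fixes G :: "('v, 'e, 'a :: metric_space) gdms_data"
  assumes finite_verts: "finite (verts G)"
    and countable_edges: "countable (edges G)"
    and two_edges: "\<exists>a\<in>edges G. \<exists>b\<in>edges G. a \<noteq> b"
    and ter_verts: "\<And>e. e \<in> edges G \<Longrightarrow> ter G e \<in> verts G"
    and ini_verts: "\<And>e. e \<in> edges G \<Longrightarrow> ini G e \<in> verts G"
    and adm_ter_ini: "\<And>a b. \<lbrakk>a \<in> edges G; b \<in> edges G; adm G a b\<rbrakk> \<Longrightarrow> ter G a = ini G b"
    and ex_ter: "\<And>v. v \<in> verts G \<Longrightarrow> \<exists>e\<in>edges G. ter G e = v"
    and ex_ini: "\<And>v. v \<in> verts G \<Longrightarrow> \<exists>e\<in>edges G. ini G e = v"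
    and piece_nonempty: "\<And>v. v \<in> verts G \<Longrightarrow> piece G v \<noteq> {}"
    and piece_compact: "\<And>v. v \<in> verts G \<Longrightarrow> compact (piece G v)"
    and phi_into: "\<And>e. e \<in> edges G \<Longrightarrow> phi G e ` piece G (ter G e) \<subseteq> piece G (ini G e)"
    and phi_inj: "\<And>e. e \<in> edges G \<Longrightarrow> inj_on (phi G e) (piece G (ter G e))"
    and phi_contraction:
      "\<exists>s. 0 < s \<and> s < 1 \<and> (\<forall>e\<in>edges G. s-lipschitz_on (piece G (ter G e)) (phi G e))"

definition words_of_length :: "('v, 'e, 'a) gdms_data \<Rightarrow> nat \<Rightarrow> 'e list set" where
  "words_of_length G n = {w. length w = n \<and> set w \<subseteq> edges G \<and> successively (adm G) w}"

definition fin_words :: "('v, 'e, 'a) gdms_data \<Rightarrow> 'e list set" where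
  "fin_words G = (\<Union>n. words_of_length G n)"

text \<open>Infinite words are indexed from 0.\<close>

definition inf_words :: "('v, 'e, 'a) gdms_data \<Rightarrow> (nat \<Rightarrow> 'e) set" where
  "inf_words G = {w. (\<forall>k. w k \<in> edges G) \<and> (\<forall>k. adm G (w k) (w (Suc k)))}"

definition word_map :: "('v, 'e, 'a) gdms_data \<Rightarrow> 'e list \<Rightarrow> 'a \<Rightarrow> 'a" where
  "word_map G w = foldr (\<lambda>e f. phi G e \<circ> f) w id"

definition coding_map :: "('v, 'e, 'a) gdms_data \<Rightarrow> (nat \<Rightarrow> 'e) \<Rightarrow> 'a" where
  "coding_map G w =
     (THE x. x \<in> (\<Inter>n. word_map G (map w [0..<Suc n]) ` piece G (ter G (w n))))"

definition limit_set :: "('v, 'e, 'a) gdms_data \<Rightarrow> 'a set" where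
  "limit_set G = coding_map G ` inf_words G"

definition total_space :: "('v, 'e, 'a) gdms_data \<Rightarrow> 'a set" where
  "total_space G = (\<Union>v\<in>verts G. piece G v)"

definition finite_gdms :: "('v, 'e, 'a) gdms_data \<Rightarrow> bool" where
  "finite_gdms G \<longleftrightarrow> finite (edges G)"

definition irreducible_gdms :: "('v, 'e, 'a) gdms_data \<Rightarrow> bool" where
  "irreducible_gdms G \<longleftrightarrow>
     (\<forall>a\<in>edges G. \<forall>b\<in>edges G. \<exists>w\<in>fin_words G. [a] @ w @ [b] \<in> fin_words G)"


section \<open>Conformal systems\<close>

definition is_similarity :: "('a :: metric_space \<Rightarrow> 'a) \<Rightarrow> bool" where
  "is_similarity f \<longleftrightarrow> (\<exists>c>0. \<forall>x y. dist (f x) (f y) = c * dist x y)"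

text \<open>The next three notions are meant for open \<open>U\<close>.\<close>

definition C1_on :: "('a :: euclidean_space \<Rightarrow> 'b :: euclidean_space) \<Rightarrow> 'a set \<Rightarrow> bool" where
  "C1_on f U \<longleftrightarrow>
     (\<exists>D :: 'a \<Rightarrow> 'a \<Rightarrow>\<^sub>L 'b.
        (\<forall>x\<in>U. (f has_derivative blinfun_apply (D x)) (at x)) \<and> continuous_on U D)"

text \<open>A diffeomorphism \<^emph>\<open>into\<close> \<open>W\<close> is a diffeomorphism onto an open subset of \<open>W\<close>.\<close>

definition C1_diffeo_into :: "('a :: euclidean_space \<Rightarrow> 'a) \<Rightarrow> 'a set \<Rightarrow> 'a set \<Rightarrow> bool" where
  "C1_diffeo_into f U W \<longleftrightarrow>
     f ` U \<subseteq> W \<and> open (f ` U) \<and> inj_on f U \<and> C1_on f U \<and> C1_on (inv_into U f) (f ` U)"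

definition conformal_on :: "('a :: euclidean_space \<Rightarrow> 'a) \<Rightarrow> 'a set \<Rightarrow> bool" where
  "conformal_on f U \<longleftrightarrow> (\<forall>x\<in>U. is_similarity (frechet_derivative f (at x)))"

definition deriv_norm :: "('a :: euclidean_space \<Rightarrow> 'a) \<Rightarrow> 'a \<Rightarrow> real" where
  "deriv_norm f p = onorm (frechet_derivative f (at p))"

text \<open>The extension of the generator of \<open>e\<close> to \<open>W (ter G e)\<close> is \<open>phi G e\<close> itself: since \<open>phi G e\<close>
  is total, fixing an extension amounts to fixing its values off \<open>piece G (ter G e)\<close>. The
  pieces are pairwise disjoint because the sets \<open>S v\<close> are. Bounded distortion is vacuous for the
  empty word, which has no terminal vertex and stands for the identity.\<close>

locale conformal_gdms = gdms G
  for G :: "('v, 'e, real ^ 'n) gdms_data" +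
  fixes W :: "'v \<Rightarrow> (real ^ 'n) set"
    and S :: "'v \<Rightarrow> (real ^ 'n) set"
  assumes piece_connected: "\<And>v. v \<in> verts G \<Longrightarrow> connected (piece G v)"
    and piece_regular: "\<And>v. v \<in> verts G \<Longrightarrow> piece G v = closure (interior (piece G v))"
    and open_set_condition:
      "\<And>a b. \<lbrakk>a \<in> edges G; b \<in> edges G; a \<noteq> b\<rbrakk> \<Longrightarrow>
         phi G a ` interior (piece G (ter G a)) \<inter> phi G b ` interior (piece G (ter G b)) = {}"
    and W_open: "\<And>v. v \<in> verts G \<Longrightarrow> open (W v)"
    and W_connected: "\<And>v. v \<in> verts G \<Longrightarrow> connected (W v)"
    and piece_subset_W: "\<And>v. v \<in> verts G \<Longrightarrow> piece G v \<subseteq> W v"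
    and phi_diffeo:
      "\<And>e. e \<in> edges G \<Longrightarrow> C1_diffeo_into (phi G e) (W (ter G e)) (W (ini G e))"
    and phi_conformal: "\<And>e. e \<in> edges G \<Longrightarrow> conformal_on (phi G e) (W (ter G e))"
    and S_compact: "\<And>v. v \<in> verts G \<Longrightarrow> compact (S v)"
    and piece_subset_S: "\<And>v. v \<in> verts G \<Longrightarrow> piece G v \<subseteq> interior (S v)"
    and S_subset_W: "\<And>v. v \<in> verts G \<Longrightarrow> S v \<subseteq> W v"
    and S_disjoint: "disjoint_family_on S (verts G)"
    and bounded_distortion:
      "\<exists>\<alpha>>0. \<exists>K\<ge>1. \<forall>w\<in>fin_words G. w \<noteq> [] \<longrightarrow>
         (\<forall>p\<in>S (ter G (last w)). \<forall>q\<in>S (ter G (last w)).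
            \<bar>deriv_norm (word_map G w) p / deriv_norm (word_map G w) q - 1\<bar>
              \<le> K * dist p q powr \<alpha> \<and>
            inverse K \<le> deriv_norm (word_map G w) p / deriv_norm (word_map G w) q \<and>
            deriv_norm (word_map G w) p / deriv_norm (word_map G w) q \<le> K)"


section \<open>Directed porosity\<close>

text \<open>With open balls the set below contains 0, and for \<open>r > 0\<close> it is bounded above by 1, so the
  real supremum is meaningful. Closed balls give the same value whenever it is positive.\<close>

definition por_dir :: "'a :: euclidean_space \<Rightarrow> 'a set \<Rightarrow> 'a \<Rightarrow> real \<Rightarrow> real" where
  "por_dir v U x r =
     Sup {c. 0 \<le> c \<and> (\<exists>y. y \<in> (+) x ` span {v} \<and> ball y (c * r) \<subseteq> ball x r - U)}"

definition directed_porous :: "'a :: euclidean_space \<Rightarrow> 'a set \<Rightarrow> bool" where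
  "directed_porous v U \<longleftrightarrow>
     (\<exists>c r0. 0 < c \<and> c < 1 \<and> 0 < r0 \<and>
        (\<forall>x\<in>U. \<forall>r. 0 < r \<and> r < r0 \<longrightarrow> por_dir v U x r \<ge> c))"

end

theory Submission
  imports Defs
begin

text \<open>Cut every infinite word at the first moment its cylinder has diameter at most \<open>r / 2\<close>. By
  bounded distortion all these stopping cylinders have derivative comparable to \<open>r\<close>, and since the
  limit set stays away from the boundary of \<open>X\<close>, each of its points is the centre of a ball of radius
  comparable to \<open>r\<close> inside its own open stopping cylinder. Follow the line through \<open>x\<close> in direction
  \<open>v\<close> until it leaves the open stopping cylinder of \<open>x\<close>, at \<open>z\<close>. Distinct open stopping cylinders are
  disjoint, so \<open>z\<close> lies in none of them and is therefore at distance comparable to \<open>r\<close> from the limit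
  set.\<close>

section \<open>Metric and differential preliminaries\<close>

text \<open>Connectedness lets chains in \<open>X\<close> with steps shorter than
  \<open>\<eta>\<close> run from a base point to every point, and compactness bounds their length by
  one \<open>n\<close>. Joining two points through the base point gives \<open>N = 2 * n\<close>.
  This \<open>N\<close> depends only on \<open>X\<close> and \<open>\<eta>\<close>, so one constant
  serves infinitely many maps \<open>f\<close>.\<close>

lemma connected_compact_oscillation_bound:
  fixes X :: "'a :: metric_space set"
  assumes "compact X" "connected X" "0 < \<eta>"
  shows "\<exists>N\<ge>0. \<forall>(f :: 'a \<Rightarrow> 'b :: metric_space) L.
    (\<forall>x\<in>X. \<forall>y\<in>X. dist x y < \<eta> \<longrightarrow> dist (f x) (f y) \<le> L) \<longrightarrow>
    (\<forall>x\<in>X. \<forall>y\<in>X. dist (f x) (f y) \<le> N * L)"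
proof (cases "X = {}")
  case True
  then show ?thesis by auto
next
  case False
  then obtain x0 where x0: "x0 \<in> X" by blast
  define r where "r = {(x, y). x \<in> X \<and> y \<in> X \<and> dist x y < \<eta>}"
  \<comment> \<open>The points reached from \<open>x0\<close> by exactly \<open>k\<close> steps. A
    step may stay in place because \<open>0 < \<eta>\<close>, which makes these sets increase with
    \<open>k\<close>.\<close>
  define R where "R k = {y. (x0, y) \<in> r ^^ k}" for k
  define U where "U k = (\<Union>x\<in>R k. ball x \<eta>)" for k
  have R0: "R 0 = {x0}" by (auto simp: R_def)
  have RX: "R k \<subseteq> X" for k
    by (cases k) (auto simp: R_def r_def x0)
  have R_Suc: "R (Suc k) = X \<inter> U k" for k
    using RX[of k] by (auto simp: R_def U_def r_def)
  have R_U: "R k \<subseteq> U k" for k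
    using \<open>0 < \<eta>\<close> by (force simp: U_def)
  have mono_R: "R k \<subseteq> R (Suc k)" for k
    using R_U RX R_Suc by blast
  have R_mono: "R j \<subseteq> R k" if "j \<le> k" for j k
    using lift_Suc_mono_le[of R, OF mono_R that] .
  have cover: "X \<subseteq> (\<Union>k. U k)"
  proof -
    \<comment> \<open>\<open>V\<close> is the \<open>\<eta>\<close>-neighbourhood of the unreached
      points. A point of \<open>X\<close> lying in \<open>V\<close> and in some \<open>U k\<close>
      would make an unreached point reachable one step later, so the two open sets would disconnect
      \<open>X\<close> if \<open>V\<close> met it.\<close>
    define V where "V = (\<Union>x\<in>X - (\<Union>k. U k). ball x \<eta>)"
    have "open (\<Union>k. U k)" "open V" by (auto simp: U_def V_def)
    moreover have "X \<subseteq> (\<Union>k. U k) \<union> V" using \<open>0 < \<eta>\<close> by (force simp: V_def)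
    moreover have "(\<Union>k. U k) \<inter> V \<inter> X = {}"
    proof -
      have False if "y \<in> X" "y \<in> U k" "x \<in> X" "\<forall>k. x \<notin> U k" "dist x y < \<eta>" for x y k
      proof -
        have "y \<in> R (Suc k)" using that R_Suc by blast
        then have "x \<in> U (Suc k)"
          unfolding U_def using \<open>dist x y < \<eta>\<close> by (intro UN_I[of y]) (simp_all add: dist_commute)
        then show False using that by blast
      qed
      then show ?thesis unfolding V_def by auto
    qed
    moreover have "(\<Union>k. U k) \<inter> X \<noteq> {}" using x0 R0 R_U[of 0] by blast
    ultimately have "V \<inter> X = {}"
      using \<open>connected X\<close> unfolding connected_def by blast
    then show ?thesis using \<open>X \<subseteq> (\<Union>k. U k) \<union> V\<close> by blast
  qed
  have "\<exists>n. X \<subseteq> R n"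
  proof -
    obtain C where C: "finite C" "X \<subseteq> (\<Union>k\<in>C. U k)"
      using compactE_image[of X UNIV U] \<open>compact X\<close> cover by (auto simp: U_def)
    have "X \<subseteq> R (Suc (Max C))"
    proof
      fix x assume x: "x \<in> X"
      then obtain k where k: "k \<in> C" "x \<in> U k" using C by blast
      then have "x \<in> R (Suc k)" using x R_Suc by blast
      moreover have "Suc k \<le> Suc (Max C)" using C k by simp
      ultimately show "x \<in> R (Suc (Max C))" using R_mono by blast
    qed
    then show ?thesis by blast
  qed
  then obtain n where n: "X \<subseteq> R n" by blast
  have bound: "dist (f x) (f y) \<le> 2 * real n * L"
    if f: "\<forall>x\<in>X. \<forall>y\<in>X. dist x y < \<eta> \<longrightarrow> dist (f x) (f y) \<le> L" and "x \<in> X" "y \<in> X"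
    for f :: "'a \<Rightarrow> 'b" and L x y
  proof -
    have step: "y \<in> R k \<Longrightarrow> dist (f x0) (f y) \<le> real k * L" for k y
    proof (induction k arbitrary: y)
      case 0
      then show ?case by (simp add: R0)
    next
      case (Suc k)
      then obtain x where x: "x \<in> R k" "dist x y < \<eta>" "y \<in> X"
        by (auto simp: R_Suc U_def)
      then have "dist (f x) (f y) \<le> L" using f RX by blast
      moreover have "dist (f x0) (f x) \<le> real k * L" using Suc.IH x by blast
      ultimately show ?case
        using dist_triangle[of "f x0" "f y" "f x"] by (simp add: algebra_simps)
    qed
    have "dist (f x0) (f x) \<le> real n * L" "dist (f x0) (f y) \<le> real n * L"
      using step n that by blast+
    then show ?thesis
      using dist_triangle3[of "f x" "f y" "f x0"] by linarith
  qed
  show ?thesis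
    by (rule exI[of _ "2 * real n"]) (use bound in auto)
qed

text \<open>Were the largest ball around \<open>f q\<close> inside the image smaller than claimed, its preimage would
  stay in a smaller concentric ball by the mean value inequality for the inverse, and compactness
  would push the larger ball's boundary back into the image.\<close>

lemma ball_subset_image_ball:
  fixes f :: "'a :: euclidean_space \<Rightarrow> 'a"
  assumes inj: "inj_on f (ball q \<delta>)" and "0 < m" "0 < \<delta>"
    and deriv: "\<And>p. p \<in> ball q \<delta> \<Longrightarrow>
      \<exists>D. (f has_derivative D) (at p) \<and> (\<forall>h. m * norm h \<le> norm (D h))"
  shows "ball (f q) (m * \<delta>) \<subseteq> f ` ball q \<delta>"
proof (rule ccontr)
  assume no: "\<not> ball (f q) (m * \<delta>) \<subseteq> f ` ball q \<delta>"
  define V where "V = f ` ball q \<delta>"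
  define g where "g = inv_into (ball q \<delta>) f"
  have gf: "g (f p) = p" if "p \<in> ball q \<delta>" for p
    using inj that by (simp add: g_def)
  have cont: "continuous_on (ball q \<delta>) f"
    by (metis continuous_at_imp_continuous_on deriv has_derivative_continuous)
  have "open V"
    unfolding V_def using invariance_of_domain[OF cont open_ball inj] .
  have g_deriv: "\<exists>D. (g has_derivative D) (at (f p)) \<and> onorm D \<le> 1 / m" if p: "p \<in> ball q \<delta>" for p
  proof -
    obtain D where D: "(f has_derivative D) (at p)" "\<And>h. m * norm h \<le> norm (D h)"
      using deriv[OF p] by blast
    have lin: "linear D" using D(1) has_derivative_linear by blast
    have "inj D"
      unfolding linear_injective_0[OF lin] using D(2) \<open>0 < m\<close>
      by (metis mult_le_0_iff norm_le_zero_iff norm_zero not_le order_refl)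
    then obtain D' where D': "linear D'" "\<And>x. D' (D x) = x" "\<And>x. D (D' x) = x"
      using linear_injective_isomorphism[OF lin] by blast
    have "(g has_derivative D') (at (f p))"
      by (rule has_derivative_inverse_strong[OF open_ball p cont gf D(1)]) (auto simp: D')
    moreover have "onorm D' \<le> 1 / m"
    proof (rule onorm_bound)
      show "norm (D' x) \<le> 1 / m * norm x" for x
        using D(2)[of "D' x"] D'(3)[of x] \<open>0 < m\<close> by (simp add: field_simps)
    qed (use \<open>0 < m\<close> in simp)
    ultimately show ?thesis by blast
  qed
  obtain y where y: "y \<in> ball (f q) (m * \<delta>)" "y \<in> - V" using no V_def by blast
  have "closed (- V)" using \<open>open V\<close> by (simp add: closed_def)
  \<comment> \<open>A nearest point of the complement: its distance \<open>\<rho>\<close> is the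
    radius of the largest ball around \<open>f q\<close> inside \<open>V\<close>, and
    \<open>z\<close> lies on the boundary sphere of that ball.\<close>
  then obtain z where z: "z \<in> - V" "\<And>y. y \<in> - V \<Longrightarrow> dist (f q) z \<le> dist (f q) y"
    using distance_attains_inf[of "- V" "f q"] y by blast
  define \<rho> where "\<rho> = dist (f q) z"
  have \<rho>: "\<rho> < m * \<delta>" using z(2)[OF y(2)] y by (simp add: \<rho>_def)
  have fq: "f q \<in> V" using \<open>0 < \<delta>\<close> by (simp add: V_def)
  then have "0 < \<rho>" using z(1) by (auto simp: \<rho>_def)
  have sub: "ball (f q) \<rho> \<subseteq> V" using z(2) by (fastforce simp: \<rho>_def)
  have "ball (f q) \<rho> \<subseteq> f ` cball q (\<rho> / m)"
  proof
    fix u assume u: "u \<in> ball (f q) \<rho>"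
    have "\<exists>D. (g has_derivative D) (at x within ball (f q) \<rho>) \<and> onorm D \<le> 1 / m"
      if "x \<in> ball (f q) \<rho>" for x
      using that sub g_deriv V_def has_derivative_at_withinI by blast
    then obtain g' where g': "\<And>x. x \<in> ball (f q) \<rho> \<Longrightarrow>
        (g has_derivative g' x) (at x within ball (f q) \<rho>) \<and> onorm (g' x) \<le> 1 / m"
      by metis
    have "norm (g u - g (f q)) \<le> 1 / m * norm (u - f q)"
      by (rule differentiable_bound[of "ball (f q) \<rho>" g g']) (use g' u \<open>0 < \<rho>\<close> in auto)
    also have "\<dots> \<le> \<rho> / m"
      using u \<open>0 < m\<close> by (auto simp: dist_norm norm_minus_commute field_simps)
    finally have "dist q (g u) \<le> \<rho> / m"
      using gf[of q] \<open>0 < \<delta>\<close> by (simp add: dist_norm norm_minus_commute)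
    moreover have "u = f (g u)"
      using u sub by (auto simp: g_def V_def f_inv_into_f)
    ultimately show "u \<in> f ` cball q (\<rho> / m)" by auto
  qed
  moreover have cb: "cball q (\<rho> / m) \<subseteq> ball q \<delta>"
    using \<rho> \<open>0 < m\<close> by (simp add: cball_subset_ball_iff field_simps)
  then have "compact (f ` cball q (\<rho> / m))"
    by (intro compact_continuous_image continuous_on_subset[OF cont]) auto
  ultimately have "closure (ball (f q) \<rho>) \<subseteq> f ` cball q (\<rho> / m)"
    by (simp add: closure_minimal compact_imp_closed)
  moreover have "z \<in> closure (ball (f q) \<rho>)"
    using \<open>0 < \<rho>\<close> by (simp add: \<rho>_def)
  ultimately have "z \<in> V" using image_mono[OF cb, of f] unfolding V_def by blast
  then show False using z(1) by blast
qed

section \<open>Conformal derivatives and the chain rule\<close>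

text \<open>The derivative scales every vector by the same factor. Hence \<open>deriv_norm\<close>
  is multiplicative under composition and bounds the derivative from below as well as from
  above.\<close>

definition conformal_at :: "('a :: euclidean_space \<Rightarrow> 'a) \<Rightarrow> 'a \<Rightarrow> bool" where
  "conformal_at f x \<longleftrightarrow> 0 < deriv_norm f x \<and>
     (\<exists>D. (f has_derivative D) (at x) \<and> (\<forall>h. norm (D h) = deriv_norm f x * norm h))"

lemma deriv_norm_eqI:
  fixes f :: "'a :: euclidean_space \<Rightarrow> 'a"
  assumes D: "(f has_derivative D) (at x)" and c: "0 < c" "\<And>h. norm (D h) = c * norm h"
  shows "deriv_norm f x = c"
proof -
  have "frechet_derivative f (at x) = D" using frechet_derivative_at[OF D] by simp
  moreover have "onorm D = c"
  proof (rule antisym)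
    show "onorm D \<le> c" by (rule onorm_bound) (use c in auto)
    obtain b :: 'a where b: "b \<in> Basis" using nonempty_Basis by blast
    have "norm (D b) \<le> onorm D * norm b"
      using onorm has_derivative_bounded_linear[OF D] by blast
    then show "c \<le> onorm D" using b c by simp
  qed
  ultimately show ?thesis by (simp add: deriv_norm_def)
qed

lemma conformal_atI:
  assumes "(f has_derivative D) (at x)" "0 < c" "\<And>h. norm (D h) = c * norm h"
  shows "conformal_at f x"
  using assms deriv_norm_eqI[OF assms] unfolding conformal_at_def by blast

lemma conformal_at_id: "conformal_at id x" and deriv_norm_id: "deriv_norm id x = 1"
  for x :: "'a :: euclidean_space"
  using conformal_atI[of id id x 1] deriv_norm_eqI[of id id x 1] by (auto simp: has_derivative_id)

lemma conformal_at_comp: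
  assumes "conformal_at f x" "conformal_at g (f x)"
  shows "conformal_at (g \<circ> f) x" "deriv_norm (g \<circ> f) x = deriv_norm g (f x) * deriv_norm f x"
proof -
  obtain D E where D: "(f has_derivative D) (at x)" "\<And>h. norm (D h) = deriv_norm f x * norm h"
    and E: "(g has_derivative E) (at (f x))" "\<And>h. norm (E h) = deriv_norm g (f x) * norm h"
    using assms unfolding conformal_at_def by blast
  have "((g \<circ> f) has_derivative (E \<circ> D)) (at x)"
    using D(1) E(1) by (rule diff_chain_at)
  moreover have "norm ((E \<circ> D) h) = deriv_norm g (f x) * deriv_norm f x * norm h" for h
    by (simp add: D E)
  moreover have "0 < deriv_norm g (f x) * deriv_norm f x"
    using assms by (simp add: conformal_at_def)
  ultimately show "conformal_at (g \<circ> f) x"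
    "deriv_norm (g \<circ> f) x = deriv_norm g (f x) * deriv_norm f x"
    by (blast intro: conformal_atI deriv_norm_eqI)+
qed

section \<open>Cylinder maps\<close>

definition prefix_map :: "('v, 'e, 'a) gdms_data \<Rightarrow> (nat \<Rightarrow> 'e) \<Rightarrow> nat \<Rightarrow> 'a \<Rightarrow> 'a" where
  "prefix_map G w n = word_map G (map w [0..<n])"

lemma prefix_map_0 [simp]: "prefix_map G w 0 = id"
  by (simp add: prefix_map_def word_map_def)

lemma word_map_append: "word_map G (u @ v) = word_map G u \<circ> word_map G v"
  by (induction u) (auto simp: word_map_def)

lemma word_map_single: "word_map G [e] = phi G e"
  by (simp add: word_map_def)

lemma prefix_map_Suc: "prefix_map G w (Suc n) = prefix_map G w n \<circ> phi G (w n)"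
  by (simp add: prefix_map_def word_map_append word_map_single)

lemma prefix_map_add: "prefix_map G w (m + n) = prefix_map G w m \<circ> prefix_map G (\<lambda>k. w (m + k)) n"
  by (induction n) (auto simp: prefix_map_Suc)

lemma prefix_map_cong: "(\<And>j. j < n \<Longrightarrow> w j = w' j) \<Longrightarrow> prefix_map G w n = prefix_map G w' n"
  unfolding prefix_map_def by (intro arg_cong[of _ _ "word_map G"] map_cong) auto

lemma fin_words_iff: "w \<in> fin_words G \<longleftrightarrow> set w \<subseteq> edges G \<and> successively (adm G) w"
  by (auto simp: fin_words_def words_of_length_def)

lemma shift_inf_words: "w \<in> inf_words G \<Longrightarrow> (\<lambda>k. w (m + k)) \<in> inf_words G"
  by (auto simp: inf_words_def)

lemma prefix_fin_words: "w \<in> inf_words G \<Longrightarrow> map w [0..<n] \<in> fin_words G"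
  by (auto simp: fin_words_iff inf_words_def successively_conv_nth)

text \<open>The piece \<open>ini G (w n)\<close>, equal to the terminal piece of \<open>w (n - 1)\<close>, serves as the domain of
  \<open>prefix_map G w n\<close>, which also covers \<open>n = 0\<close>.\<close>

abbreviation cylinder :: "('v, 'e, 'a) gdms_data \<Rightarrow> (nat \<Rightarrow> 'e) \<Rightarrow> nat \<Rightarrow> 'a set" where
  "cylinder G w n \<equiv> prefix_map G w n ` piece G (ini G (w n))"

context gdms
begin

lemma inf_words_edges: "w \<in> inf_words G \<Longrightarrow> w k \<in> edges G"
  by (simp add: inf_words_def)

lemma inf_words_ter: "w \<in> inf_words G \<Longrightarrow> ter G (w k) = ini G (w (Suc k))"
  using adm_ter_ini by (simp add: inf_words_def)

lemma inf_words_ini_verts: "w \<in> inf_words G \<Longrightarrow> ini G (w k) \<in> verts G"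
  using ini_verts inf_words_edges by blast

text \<open>The family \<open>P\<close> stays abstract because this lemma and the next two between
  them serve the pieces, their interiors and the neighbourhoods \<open>W\<close>.\<close>

lemma prefix_map_into:
  assumes w: "w \<in> inf_words G"
    and P: "\<And>e. e \<in> edges G \<Longrightarrow> phi G e ` P (ter G e) \<subseteq> P (ini G e)"
  shows "prefix_map G w n ` P (ini G (w n)) \<subseteq> P (ini G (w 0))"
proof (induction n)
  case (Suc n)
  have "phi G (w n) ` P (ini G (w (Suc n))) \<subseteq> P (ini G (w n))"
    using P[of "w n"] inf_words_edges[OF w] inf_words_ter[OF w] by simp
  then have "prefix_map G w n ` phi G (w n) ` P (ini G (w (Suc n))) \<subseteq>
      prefix_map G w n ` P (ini G (w n))" by (rule image_mono)
  then show ?case using Suc by (simp add: prefix_map_Suc image_comp)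
qed simp

lemma prefix_map_add_into:
  assumes w: "w \<in> inf_words G"
    and P: "\<And>e. e \<in> edges G \<Longrightarrow> phi G e ` P (ter G e) \<subseteq> P (ini G e)"
  shows "prefix_map G w (m + n) ` P (ini G (w (m + n))) \<subseteq> prefix_map G w m ` P (ini G (w m))"
proof -
  have "prefix_map G (\<lambda>k. w (m + k)) n ` P (ini G (w (m + n))) \<subseteq> P (ini G (w m))"
    using prefix_map_into[OF shift_inf_words[OF w, of m], of P n] P by simp
  then show ?thesis unfolding prefix_map_add image_comp[symmetric] by (rule image_mono)
qed

lemma prefix_map_inj_on:
  assumes w: "w \<in> inf_words G"
    and P: "\<And>e. e \<in> edges G \<Longrightarrow> phi G e ` P (ter G e) \<subseteq> P (ini G e)"
    and inj: "\<And>e. e \<in> edges G \<Longrightarrow> inj_on (phi G e) (P (ter G e))"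
  shows "inj_on (prefix_map G w n) (P (ini G (w n)))"
proof (induction n)
  case (Suc n)
  have "inj_on (phi G (w n)) (P (ini G (w (Suc n))))"
    using inj[OF inf_words_edges[OF w, of n]] inf_words_ter[OF w] by simp
  moreover have "phi G (w n) ` P (ini G (w (Suc n))) \<subseteq> P (ini G (w n))"
    using P[of "w n"] inf_words_edges[OF w] inf_words_ter[OF w] by simp
  ultimately show ?case
    unfolding prefix_map_Suc by (intro comp_inj_on inj_on_subset[OF Suc])
qed simp

section \<open>Shrinking cylinders and the coding map\<close>

text \<open>Each letter contracts by the common factor \<open>s\<close>, and finitely many compact
  pieces have a common bound on their diameters.\<close>

lemma cylinder_small:
  "\<exists>s D. 0 < s \<and> s < 1 \<and> 0 \<le> D \<and>
     (\<forall>w\<in>inf_words G. \<forall>n. continuous_on (piece G (ini G (w n))) (prefix_map G w n) \<and>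
        (\<forall>x\<in>cylinder G w n. \<forall>y\<in>cylinder G w n. dist x y \<le> s ^ n * D))"
proof -
  obtain s where s: "0 < s" "s < 1" "\<And>e. e \<in> edges G \<Longrightarrow> s-lipschitz_on (piece G (ter G e)) (phi G e)"
    using phi_contraction by blast
  have "bounded (\<Union>v\<in>verts G. piece G v)"
    using finite_verts piece_compact compact_imp_bounded by blast
  then obtain D where D: "\<And>x y. x \<in> (\<Union>v\<in>verts G. piece G v) \<Longrightarrow> y \<in> (\<Union>v\<in>verts G. piece G v) \<Longrightarrow> dist x y \<le> D"
    unfolding bounded_two_points by blast
  have lip: "(s ^ n)-lipschitz_on (piece G (ini G (w n))) (prefix_map G w n)" if w: "w \<in> inf_words G" for w n
  proof (induction n)
    case 0
    then show ?case by (simp add: lipschitz_on_def)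
  next
    case (Suc n)
    have "phi G (w n) ` piece G (ini G (w (Suc n))) \<subseteq> piece G (ini G (w n))"
      using phi_into[of "w n"] inf_words_edges[OF w] inf_words_ter[OF w] by simp
    then have "(s ^ n)-lipschitz_on (phi G (w n) ` piece G (ini G (w (Suc n)))) (prefix_map G w n)"
      using Suc lipschitz_on_subset by blast
    moreover have "s-lipschitz_on (piece G (ini G (w (Suc n)))) (phi G (w n))"
      using s(3)[OF inf_words_edges[OF w, of n]] inf_words_ter[OF w] by simp
    ultimately have "(s ^ n * s)-lipschitz_on (piece G (ini G (w (Suc n)))) (prefix_map G w n \<circ> phi G (w n))"
      using lipschitz_on_compose by blast
    then show ?case by (simp add: prefix_map_Suc mult.commute)
  qed
  \<comment> \<open>The bound \<open>D\<close> comes without a sign, so \<open>max D 0\<close>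
    supplies the nonnegative constant.\<close>
  have "dist (prefix_map G w n a) (prefix_map G w n b) \<le> s ^ n * max D 0"
    if w: "w \<in> inf_words G" and ab: "a \<in> piece G (ini G (w n))" "b \<in> piece G (ini G (w n))" for w n a b
  proof -
    have "dist (prefix_map G w n a) (prefix_map G w n b) \<le> s ^ n * dist a b"
      using lipschitz_onD[OF lip[OF w] ab] .
    also have "\<dots> \<le> s ^ n * max D 0"
      using D[of a b] ab inf_words_ini_verts[OF w] s by (intro mult_left_mono) (auto simp: le_max_iff_disj)
    finally show ?thesis .
  qed
  then show ?thesis
    using s lip lipschitz_on_continuous_on
    by (intro exI[of _ s] exI[of _ "max D 0"]) (auto, blast)
qed

text \<open>The clause \<open>1 \<le> n\<close> serves the stopping lengths, which are positive by
  definition.\<close>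

lemma cylinder_arbitrarily_small:
  assumes w: "w \<in> inf_words G" and "0 < \<epsilon>"
  shows "\<exists>n\<ge>1. \<forall>x\<in>cylinder G w n. \<forall>y\<in>cylinder G w n. dist x y < \<epsilon>"
proof -
  obtain s D where s: "0 < s" "s < 1" "0 \<le> D"
    and d: "\<And>n x y. x \<in> cylinder G w n \<Longrightarrow> y \<in> cylinder G w n \<Longrightarrow> dist x y \<le> s ^ n * D"
    using cylinder_small w by blast
  have "(\<lambda>n. s ^ n * D) \<longlonglongrightarrow> 0 * D"
    using s by (intro tendsto_intros LIMSEQ_realpow_zero) auto
  then have "eventually (\<lambda>n. s ^ n * D < \<epsilon>) sequentially"
    using \<open>0 < \<epsilon>\<close> by (simp add: order_tendsto_iff)
  then have "eventually (\<lambda>n. s ^ n * D < \<epsilon> \<and> 1 \<le> n) sequentially"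
    using eventually_ge_at_top eventually_conj by blast
  then obtain n where "s ^ n * D < \<epsilon>" "1 \<le> n"
    using eventually_happens'[OF sequentially_bot] by blast
  then show ?thesis using d by (meson le_less_trans)
qed

lemma cylinder_antimono:
  assumes w: "w \<in> inf_words G" and "m \<le> n"
  shows "cylinder G w n \<subseteq> cylinder G w m"
  using prefix_map_add_into[OF w, of "piece G" m "n - m"] phi_into assms by simp

lemma coding_map_unique:
  assumes w: "w \<in> inf_words G" and "\<And>n. x \<in> cylinder G w n" "\<And>n. y \<in> cylinder G w n"
  shows "x = y"
proof (rule ccontr)
  assume "x \<noteq> y"
  then obtain n where "dist x y < dist x y"
    using cylinder_arbitrarily_small[OF w, of "dist x y"] assms by (meson zero_less_dist_iff)
  then show False by simp
qed

lemma coding_map_eqI: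
  assumes w: "w \<in> inf_words G" and x: "\<And>n. x \<in> cylinder G w n"
  shows "coding_map G w = x"
proof -
  \<comment> \<open>\<open>coding_map\<close> intersects only cylinders of positive length. Length 0
    is recovered below from the nesting of cylinders.\<close>
  have eq: "word_map G (map w [0..<Suc n]) ` piece G (ter G (w n)) = cylinder G w (Suc n)" for n
    using inf_words_ter[OF w] by (simp add: prefix_map_def)
  have "y \<in> cylinder G w n" if "y \<in> (\<Inter>n. cylinder G w (Suc n))" for y n
    using cylinder_antimono[OF w, of n "Suc n"] that by auto
  then show ?thesis
    unfolding coding_map_def eq
    using x coding_map_unique[OF w] by (intro the_equality) blast+
qed

text \<open>Cylinders are nonempty, compact and nested, so they have a common point, and their
  shrinking diameters make it the point that \<open>coding_map\<close> picks.\<close>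

lemma coding_map_in_cylinder:
  assumes w: "w \<in> inf_words G"
  shows "coding_map G w \<in> cylinder G w n"
proof -
  have compact: "compact (cylinder G w n)" for n
    using cylinder_small w inf_words_ini_verts[OF w]
    by (intro compact_continuous_image piece_compact) blast+
  have "cylinder G w 0 \<inter> \<Inter>(cylinder G w ` UNIV) \<noteq> {}"
  proof (rule compact_imp_fip_image[OF compact])
    show "closed (cylinder G w n)" for n
      by (intro compact_imp_closed compact)
    fix I :: "nat set" assume "finite I"
    then obtain N where "\<And>n. n \<in> I \<Longrightarrow> n \<le> N"
      using finite_nat_set_iff_bounded_le[of I] by blast
    then have "cylinder G w N \<subseteq> cylinder G w 0 \<inter> \<Inter>(cylinder G w ` I)"
      by (intro Int_greatest INF_greatest cylinder_antimono[OF w]) auto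
    moreover have "cylinder G w N \<noteq> {}"
      using inf_words_ini_verts[OF w] piece_nonempty by blast
    ultimately show "cylinder G w 0 \<inter> \<Inter>(cylinder G w ` I) \<noteq> {}"
      using subset_empty by metis
  qed
  then obtain x where "x \<in> cylinder G w 0 \<inter> \<Inter>(cylinder G w ` UNIV)"
    unfolding ex_in_conv[symmetric] by (rule exE)
  then have x: "\<And>n. x \<in> cylinder G w n" by (meson IntD2 INT_D UNIV_I)
  then show ?thesis using coding_map_eqI[OF w x] by simp
qed

text \<open>This writes a limit point as the image, under a cylinder map, of another limit point,
  around which its piece contains a ball of fixed radius.\<close>

lemma coding_map_shift:
  assumes w: "w \<in> inf_words G"
  shows "coding_map G w = prefix_map G w m (coding_map G (\<lambda>k. w (m + k)))"
proof (rule coding_map_eqI[OF w])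
  fix n
  have "prefix_map G w m (coding_map G (\<lambda>k. w (m + k))) \<in> cylinder G w (m + n)"
    using coding_map_in_cylinder[OF shift_inf_words[OF w, of m], of n]
    by (auto simp: prefix_map_add)
  then show "prefix_map G w m (coding_map G (\<lambda>k. w (m + k))) \<in> cylinder G w n"
    using cylinder_antimono[OF w, of n "m + n"] by auto
qed

end


section \<open>Stopping words\<close>

text \<open>Diameters are expressed through pairwise distances. Starting at length 1 gives each
  stopping word a last letter, which fixes the domain piece when two stopping words are compared and
  leaves a parent cylinder on removal.\<close>

definition stops_at :: "('v, 'e, 'a :: metric_space) gdms_data \<Rightarrow> (nat \<Rightarrow> 'e) \<Rightarrow> real \<Rightarrow> nat \<Rightarrow> bool" where
  "stops_at G w r n \<longleftrightarrow> 1 \<le> n \<and> (\<forall>x\<in>cylinder G w n. \<forall>y\<in>cylinder G w n. dist x y \<le> r) \<and>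
     (\<forall>m. 1 \<le> m \<and> m < n \<longrightarrow> (\<exists>x\<in>cylinder G w m. \<exists>y\<in>cylinder G w m. r < dist x y))"

abbreviation open_cylinder :: "('v, 'e, 'a :: metric_space) gdms_data \<Rightarrow> (nat \<Rightarrow> 'e) \<Rightarrow> nat \<Rightarrow> 'a set" where
  "open_cylinder G w n \<equiv> prefix_map G w n ` interior (piece G (ini G (w n)))"

lemma (in gdms) ex_stops_at:
  assumes "w \<in> inf_words G" "0 < r"
  shows "\<exists>n. stops_at G w r n"
proof -
  define P where "P n \<longleftrightarrow> 1 \<le> n \<and> (\<forall>x\<in>cylinder G w n. \<forall>y\<in>cylinder G w n. dist x y \<le> r)" for n
  have "\<exists>n. P n"
    using cylinder_arbitrarily_small[OF assms] unfolding P_def by (meson less_imp_le)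
  then obtain n where "P n" "\<And>m. m < n \<Longrightarrow> \<not> P m"
    using exists_least_iff[of P] by blast
  then have "stops_at G w r n"
    by (auto simp: P_def stops_at_def not_le)
  then show ?thesis by blast
qed

section \<open>Separation of open cylinders\<close>

context conformal_gdms
begin

lemma piece_subset_S': "v \<in> verts G \<Longrightarrow> piece G v \<subseteq> S v"
  using piece_subset_S interior_subset by blast

lemma phi_interior:
  assumes "e \<in> edges G"
  shows "phi G e ` interior (piece G (ter G e)) \<subseteq> interior (piece G (ini G e))"
proof (rule interior_maximal)
  show "phi G e ` interior (piece G (ter G e)) \<subseteq> piece G (ini G e)"
    using phi_into[OF assms] interior_subset by blast
  have "continuous_on (piece G (ter G e)) (phi G e)"
    using phi_contraction assms lipschitz_on_continuous_on by blast
  then show "open (phi G e ` interior (piece G (ter G e)))"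
    using phi_inj[OF assms] interior_subset
    by (intro invariance_of_domain) (auto intro: continuous_on_subset inj_on_subset)
qed

lemma open_open_cylinder:
  assumes w: "w \<in> inf_words G"
  shows "open (open_cylinder G w n)"
proof (rule invariance_of_domain)
  show "continuous_on (interior (piece G (ini G (w n)))) (prefix_map G w n)"
    using cylinder_small w interior_subset continuous_on_subset by metis
  show "inj_on (prefix_map G w n) (interior (piece G (ini G (w n))))"
    using prefix_map_inj_on[OF w, of "piece G" n] phi_into phi_inj interior_subset inj_on_subset
    by metis
qed simp

text \<open>At the first differing letter the open set condition separates the two images. The
  common prefix map is injective on both together, so it keeps them apart, and the longer open
  cylinders lie inside.\<close>

lemma open_cylinder_disjoint:
  assumes w: "w \<in> inf_words G" and w': "w' \<in> inf_words G"
    and k: "k < n" "k < n'" and eq: "\<And>j. j < k \<Longrightarrow> w j = w' j" and neq: "w k \<noteq> w' k"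
  shows "open_cylinder G w n \<inter> open_cylinder G w' n' = {}"
proof -
  have sub: "open_cylinder G u m \<subseteq>
      prefix_map G u k ` phi G (u k) ` interior (piece G (ter G (u k)))"
    if u: "u \<in> inf_words G" and "k < m" for u m
  proof -
    have "open_cylinder G u (Suc k + (m - Suc k)) \<subseteq> open_cylinder G u (Suc k)"
      using prefix_map_add_into[OF u, of "\<lambda>v. interior (piece G v)"] phi_interior by blast
    then show ?thesis
      using \<open>k < m\<close> inf_words_ter[OF u] by (simp add: prefix_map_Suc image_comp)
  qed
  define A where "A = phi G (w k) ` interior (piece G (ter G (w k)))"
  define B where "B = phi G (w' k) ` interior (piece G (ter G (w' k)))"
  have pre: "prefix_map G w' k = prefix_map G w k"
    by (rule prefix_map_cong) (simp add: eq)
  \<comment> \<open>For \<open>k = 0\<close> the prefix map is the identity. Otherwise both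
    differing letters follow the same letter, hence start at the same vertex, and both images lie in
    one piece on which the prefix map is injective.\<close>
  have "inj_on (prefix_map G w k) (A \<union> B)"
  proof (cases k)
    case (Suc j)
    have "ini G (w k) = ini G (w' k)"
      using inf_words_ter[OF w, of j] inf_words_ter[OF w', of j] eq[of j] Suc by simp
    moreover have "A \<subseteq> piece G (ini G (w k))" "B \<subseteq> piece G (ini G (w' k))"
      using phi_into[OF inf_words_edges[OF w, of k]] phi_into[OF inf_words_edges[OF w', of k]]
        interior_subset unfolding A_def B_def by blast+
    ultimately have "A \<union> B \<subseteq> piece G (ini G (w k))" by simp
    then show ?thesis
      using prefix_map_inj_on[OF w, of "piece G" k] phi_into phi_inj inj_on_subset by metis
  qed simp
  moreover have "A \<inter> B = {}"
    using open_set_condition[OF inf_words_edges[OF w] inf_words_edges[OF w'] neq]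
    by (simp add: A_def B_def)
  ultimately have "prefix_map G w k ` A \<inter> prefix_map G w k ` B = {}"
    by (metis image_empty inj_on_image_Int sup_ge1 sup_ge2)
  then show ?thesis
    using sub[OF w k(1)] sub[OF w' k(2)] unfolding pre A_def B_def by blast
qed

text \<open>Words differing before either stops are separated at the first difference. Otherwise
  their cylinders coincide at the shorter stopping length, where the other word must then stop too,
  by minimality.\<close>

lemma stopping_cylinders_eq_or_disjoint:
  assumes w: "w \<in> inf_words G" and w': "w' \<in> inf_words G"
    and n: "stops_at G w r n" and n': "stops_at G w' r n'"
  shows "open_cylinder G w n = open_cylinder G w' n' \<or>
    open_cylinder G w n \<inter> open_cylinder G w' n' = {}"
proof (cases "\<exists>k. k < min n n' \<and> w k \<noteq> w' k")
  case True
  define k where "k = (LEAST k. k < min n n' \<and> w k \<noteq> w' k)"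
  have k: "k < min n n'" "w k \<noteq> w' k"
    using LeastI_ex[OF True] by (simp_all add: k_def)
  have "w j = w' j" if "j < k" for j
    using not_less_Least[of j "\<lambda>k. k < min n n' \<and> w k \<noteq> w' k"] that k by (auto simp: k_def)
  then show ?thesis
    using open_cylinder_disjoint[OF w w', of k n n'] k by simp
next
  case False
  have pos: "1 \<le> n" "1 \<le> n'" using n n' by (auto simp: stops_at_def)
  define m where "m = min n n'"
  then have "1 \<le> m" using pos by simp
  then obtain j where j: "m = Suc j" by (cases m) auto
  have same: "\<And>i. i < m \<Longrightarrow> w i = w' i" using False by (auto simp: m_def)
  have pre: "prefix_map G w m = prefix_map G w' m"
    by (rule prefix_map_cong) (rule same)
  have ini: "ini G (w m) = ini G (w' m)"
    using inf_words_ter[OF w, of j] inf_words_ter[OF w', of j] same[of j] j by simp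
  have cyl: "cylinder G w m = cylinder G w' m" by (simp add: pre ini)
  have "n = n'"
  proof (rule linorder_cases[of n n'])
    assume "n < n'"
    then have "m = n" by (simp add: m_def)
    then show ?thesis
      using n n' cyl \<open>n < n'\<close> unfolding stops_at_def by (metis not_le)
  next
    assume "n' < n"
    then have "m = n'" by (simp add: m_def)
    then show ?thesis
      using n n' cyl \<open>n' < n\<close> unfolding stops_at_def by (metis not_le)
  qed
  then show ?thesis using pre ini by (simp add: m_def)
qed

section \<open>Scale of a stopping word\<close>

lemma phi_W: "e \<in> edges G \<Longrightarrow> phi G e ` W (ter G e) \<subseteq> W (ini G e)"
  and phi_inj_W: "e \<in> edges G \<Longrightarrow> inj_on (phi G e) (W (ter G e))"
  using phi_diffeo by (auto simp: C1_diffeo_into_def)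

lemma phi_conformal_at:
  assumes e: "e \<in> edges G" and x: "x \<in> W (ter G e)"
  shows "conformal_at (phi G e) x"
proof -
  obtain D where D: "(phi G e has_derivative D) (at x)"
    using phi_diffeo[OF e] x unfolding C1_diffeo_into_def C1_on_def by blast
  moreover have "frechet_derivative (phi G e) (at x) = D"
    using frechet_derivative_at[OF D] by simp
  ultimately obtain c where c: "0 < c" "\<And>y z. dist (D y) (D z) = c * dist y z"
    using phi_conformal[OF e] x unfolding conformal_on_def is_similarity_def by metis
  have "D 0 = 0" using D has_derivative_linear linear_0 by blast
  then have "norm (D h) = c * norm h" for h
    using c(2)[of h 0] by simp
  then show ?thesis using conformal_atI[OF D] c by blast
qed

text \<open>One chain rule step. Conformality of the shorter prefix is a hypothesis so that the step
  can drive the induction that follows, while its derivative formula serves the comparison of a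
  stopping cylinder with its parent.\<close>

lemma prefix_map_Suc_conformal:
  assumes w: "w \<in> inf_words G"
    and IH: "\<And>y. y \<in> W (ini G (w n)) \<Longrightarrow> conformal_at (prefix_map G w n) y"
    and x: "x \<in> W (ini G (w (Suc n)))"
  shows "conformal_at (prefix_map G w (Suc n)) x"
    and "deriv_norm (prefix_map G w (Suc n)) x =
      deriv_norm (prefix_map G w n) (phi G (w n) x) * deriv_norm (phi G (w n)) x"
proof -
  have e: "w n \<in> edges G" and x': "x \<in> W (ter G (w n))"
    using inf_words_edges[OF w] inf_words_ter[OF w] x by auto
  then have "phi G (w n) x \<in> W (ini G (w n))" using phi_W by blast
  note * = phi_conformal_at[OF e x'] IH[OF this]
  show "conformal_at (prefix_map G w (Suc n)) x"
    "deriv_norm (prefix_map G w (Suc n)) x =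
      deriv_norm (prefix_map G w n) (phi G (w n) x) * deriv_norm (phi G (w n)) x"
    using conformal_at_comp[OF *] by (simp_all add: prefix_map_Suc)
qed

lemma prefix_map_conformal_at:
  assumes w: "w \<in> inf_words G" and x: "x \<in> W (ini G (w n))"
  shows "conformal_at (prefix_map G w n) x"
  using x
proof (induction n arbitrary: x)
  case 0
  then show ?case unfolding prefix_map_0 by (intro conformal_at_id)
next
  case (Suc n)
  then show ?case using prefix_map_Suc_conformal(1)[OF w] by blast
qed

text \<open>Bounded distortion in product form: conformality makes the denominators positive, and
  \<open>1 \<le> K\<close> covers the empty prefix, the identity. The edge clause comes from
  one-letter words, so no infinite word through the edge has to be exhibited.\<close>

lemma distortion:
  "\<exists>K\<ge>1. (\<forall>w\<in>inf_words G. \<forall>n. \<forall>p\<in>S (ini G (w n)). \<forall>q\<in>S (ini G (w n)).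
      deriv_norm (prefix_map G w n) p \<le> K * deriv_norm (prefix_map G w n) q) \<and>
    (\<forall>e\<in>edges G. \<forall>p\<in>S (ter G e). \<forall>q\<in>S (ter G e).
      deriv_norm (phi G e) p \<le> K * deriv_norm (phi G e) q)"
proof -
  obtain K where K: "1 \<le> K"
    and bd: "\<And>u p q. \<lbrakk>u \<in> fin_words G; u \<noteq> []; p \<in> S (ter G (last u)); q \<in> S (ter G (last u))\<rbrakk>
      \<Longrightarrow> deriv_norm (word_map G u) p / deriv_norm (word_map G u) q \<le> K"
    using bounded_distortion by blast
  have "deriv_norm (prefix_map G w n) p \<le> K * deriv_norm (prefix_map G w n) q"
    if w: "w \<in> inf_words G" and pq: "p \<in> S (ini G (w n))" "q \<in> S (ini G (w n))" for w n p q
  proof (cases n)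
    case 0
    then show ?thesis using K by (simp add: deriv_norm_id)
  next
    case (Suc m)
    have "q \<in> W (ini G (w n))" using pq S_subset_W inf_words_ini_verts[OF w] by blast
    then have "0 < deriv_norm (prefix_map G w n) q"
      using prefix_map_conformal_at[OF w] by (simp add: conformal_at_def)
    moreover have "deriv_norm (prefix_map G w n) p / deriv_norm (prefix_map G w n) q \<le> K"
      using bd[OF prefix_fin_words[OF w, of n], of p q] pq inf_words_ter[OF w, of m] Suc
      by (simp add: prefix_map_def)
    ultimately show ?thesis by (simp add: pos_divide_le_eq)
  qed
  moreover have "deriv_norm (phi G e) p \<le> K * deriv_norm (phi G e) q"
    if e: "e \<in> edges G" and pq: "p \<in> S (ter G e)" "q \<in> S (ter G e)" for e p q
  proof -
    have "q \<in> W (ter G e)" using pq S_subset_W ter_verts[OF e] by blast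
    then have "0 < deriv_norm (phi G e) q"
      using phi_conformal_at[OF e] by (simp add: conformal_at_def)
    moreover have "deriv_norm (phi G e) p / deriv_norm (phi G e) q \<le> K"
      using bd[of "[e]" p q] e pq by (simp add: fin_words_iff word_map_single)
    ultimately show ?thesis by (simp add: pos_divide_le_eq)
  qed
  ultimately show ?thesis using K by blast
qed

text \<open>Here finiteness of the alphabet enters. Distortion reduces each edge to the derivative
  at one point of its piece, and a minimum over finitely many positive bounds is positive.\<close>

lemma phi_deriv_lower_bound:
  assumes fin: "finite (edges G)"
  shows "\<exists>d>0. \<forall>e\<in>edges G. \<forall>p\<in>piece G (ter G e). d \<le> deriv_norm (phi G e) p"
proof -
  obtain K where K: "1 \<le> K"
    and dist: "\<And>e p q. e \<in> edges G \<Longrightarrow> p \<in> S (ter G e) \<Longrightarrow> q \<in> S (ter G e) \<Longrightarrow>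
      deriv_norm (phi G e) p \<le> K * deriv_norm (phi G e) q"
    using distortion by blast
  have "\<exists>d>0. \<forall>p\<in>piece G (ter G e). d \<le> deriv_norm (phi G e) p" if e: "e \<in> edges G" for e
  proof -
    have v: "ter G e \<in> verts G" using ter_verts[OF e] .
    obtain q where q: "q \<in> piece G (ter G e)" using piece_nonempty[OF v] by blast
    then have "0 < deriv_norm (phi G e) q"
      using phi_conformal_at[OF e] piece_subset_W[OF v] by (auto simp: conformal_at_def)
    moreover have "deriv_norm (phi G e) q \<le> K * deriv_norm (phi G e) p" if "p \<in> piece G (ter G e)" for p
      using dist[OF e] that q piece_subset_S'[OF v] by blast
    ultimately show ?thesis
      using K by (intro exI[of _ "deriv_norm (phi G e) q / K"]) (auto simp: field_simps)
  qed
  then obtain d where d: "\<And>e. e \<in> edges G \<Longrightarrow> 0 < d e"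
      "\<And>e p. e \<in> edges G \<Longrightarrow> p \<in> piece G (ter G e) \<Longrightarrow> d e \<le> deriv_norm (phi G e) p"
    by metis
  have ne: "edges G \<noteq> {}" using two_edges by blast
  show ?thesis
  proof (intro exI[of _ "Min (d ` edges G)"] conjI ballI)
    show "0 < Min (d ` edges G)" using fin ne d by (simp add: Min_gr_iff)
    show "Min (d ` edges G) \<le> deriv_norm (phi G e) p" if "e \<in> edges G" "p \<in> piece G (ter G e)" for e p
      using that d(2) fin by (meson Min_le finite_imageI imageI order_trans)
  qed
qed

text \<open>The pieces need not be convex, so the mean value inequality is only available on small balls;
  connectedness and compactness bound the number of such balls needed to join two points.\<close>

lemma cylinder_diameter_bound:
  "\<exists>M\<ge>1. \<forall>w\<in>inf_words G. \<forall>n. \<forall>p\<in>piece G (ini G (w n)). \<forall>x\<in>cylinder G w n. \<forall>y\<in>cylinder G w n.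
     dist x y \<le> M * deriv_norm (prefix_map G w n) p"
proof -
  obtain K where K: "1 \<le> K"
    and dist: "\<And>w n p q. \<lbrakk>w \<in> inf_words G; p \<in> S (ini G (w n)); q \<in> S (ini G (w n))\<rbrakk> \<Longrightarrow>
      deriv_norm (prefix_map G w n) p \<le> K * deriv_norm (prefix_map G w n) q"
    using distortion by blast
  have "\<exists>M\<ge>0. \<forall>w\<in>inf_words G. \<forall>n. ini G (w n) = v \<longrightarrow>
     (\<forall>p\<in>piece G v. \<forall>x\<in>cylinder G w n. \<forall>y\<in>cylinder G w n.
        dist x y \<le> M * deriv_norm (prefix_map G w n) p)" if v: "v \<in> verts G" for v
  proof -
    \<comment> \<open>The compact piece has positive distance from the complement of
      \<open>interior (S v)\<close>. Balls of radius \<open>\<eta>\<close> are convex and stay in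
      \<open>S v\<close>, where distortion controls the derivative.\<close>
    obtain \<eta> where \<eta>: "0 < \<eta>" "\<And>x. x \<in> piece G v \<Longrightarrow> ball x \<eta> \<subseteq> S v"
    proof -
      have "\<exists>\<eta>>0. \<forall>x\<in>piece G v. \<forall>y\<in>- interior (S v). \<eta> \<le> dist x y"
        using separate_compact_closed[OF piece_compact[OF v], of "- interior (S v)"]
          piece_subset_S[OF v] by (auto simp: closed_def)
      then obtain \<eta> where \<eta>: "0 < \<eta>"
          "\<And>x y. x \<in> piece G v \<Longrightarrow> y \<notin> interior (S v) \<Longrightarrow> \<eta> \<le> dist x y" by auto
      have "ball x \<eta> \<subseteq> S v" if "x \<in> piece G v" for x
      proof
        fix y assume "y \<in> ball x \<eta>"
        then have "y \<in> interior (S v)" using \<eta>(2)[OF that, of y] by force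
        then show "y \<in> S v" using interior_subset by blast
      qed
      then show ?thesis using that \<eta> by blast
    qed
    obtain N where N: "0 \<le> N" "\<And>(f :: real ^ 'n \<Rightarrow> real ^ 'n) L x y.
        \<lbrakk>\<forall>x\<in>piece G v. \<forall>y\<in>piece G v. dist x y < \<eta> \<longrightarrow> dist (f x) (f y) \<le> L;
         x \<in> piece G v; y \<in> piece G v\<rbrakk> \<Longrightarrow> dist (f x) (f y) \<le> N * L"
      using connected_compact_oscillation_bound[OF piece_compact[OF v] piece_connected[OF v] \<eta>(1),
          where 'b = "real ^ 'n"] by blast
    have "dist (prefix_map G w n a) (prefix_map G w n b) \<le>
        N * (K * deriv_norm (prefix_map G w n) p * \<eta>)"
      if w: "w \<in> inf_words G" and ini: "ini G (w n) = v"
        and p: "p \<in> piece G v" and ab: "a \<in> piece G v" "b \<in> piece G v" for w n p a b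
    proof (rule N(2)[OF _ ab], intro ballI impI)
      fix x y assume x: "x \<in> piece G v" and y: "y \<in> piece G v" and xy: "dist x y < \<eta>"
      let ?f = "prefix_map G w n"
      have "\<exists>D. (?f has_derivative D) (at z within ball x \<eta>) \<and> onorm D \<le> K * deriv_norm ?f p"
        if z: "z \<in> ball x \<eta>" for z
      proof -
        have zS: "z \<in> S v" using \<eta>(2)[OF x] z by blast
        then have "conformal_at ?f z"
          using prefix_map_conformal_at[OF w] S_subset_W[OF v] ini by blast
        then obtain D where D: "(?f has_derivative D) (at z)"
          unfolding conformal_at_def by blast
        moreover have "onorm D = deriv_norm ?f z"
          using frechet_derivative_at[OF D] by (simp add: deriv_norm_def)
        moreover have "deriv_norm ?f z \<le> K * deriv_norm ?f p"
          using dist[OF w, of z n p] zS ini p piece_subset_S'[OF v] by blast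
        ultimately show ?thesis using has_derivative_at_withinI by metis
      qed
      then obtain f' where f': "\<And>z. z \<in> ball x \<eta> \<Longrightarrow>
          (?f has_derivative f' z) (at z within ball x \<eta>) \<and> onorm (f' z) \<le> K * deriv_norm ?f p"
        by metis
      have "norm (?f x - ?f y) \<le> K * deriv_norm ?f p * norm (x - y)"
        by (rule differentiable_bound[of "ball x \<eta>" ?f f']) (use f' xy \<eta>(1) in auto)
      also have "\<dots> \<le> K * deriv_norm ?f p * \<eta>"
      proof (rule mult_left_mono)
        have "conformal_at ?f p"
          using prefix_map_conformal_at[OF w] piece_subset_W[OF v] ini p by blast
        then show "0 \<le> K * deriv_norm ?f p" using K by (simp add: conformal_at_def)
      qed (use xy in \<open>simp add: dist_norm\<close>)
      finally show "dist (?f x) (?f y) \<le> K * deriv_norm ?f p * \<eta>" by (simp add: dist_norm)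
    qed
    then show ?thesis
      using N(1) K \<eta>(1) by (intro exI[of _ "N * K * \<eta>"]) (auto simp: mult_ac)
  qed
  then obtain M where M: "\<And>v. v \<in> verts G \<Longrightarrow> 0 \<le> M v"
    "\<And>w n p x y. \<lbrakk>ini G (w n) \<in> verts G; w \<in> inf_words G; p \<in> piece G (ini G (w n));
        x \<in> cylinder G w n; y \<in> cylinder G w n\<rbrakk> \<Longrightarrow>
        dist x y \<le> M (ini G (w n)) * deriv_norm (prefix_map G w n) p"
    by metis
  show ?thesis
  \<comment> \<open>The sum dominates the constant of every vertex, and the added 1 ensures
    \<open>1 \<le> M\<close>, which the stopping estimate needs for words of length 1.\<close>
  proof (intro exI[of _ "1 + sum M (verts G)"] conjI ballI allI)
    show "1 \<le> 1 + sum M (verts G)" using M(1) by (simp add: sum_nonneg)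
    fix w n p x y
    assume w: "w \<in> inf_words G" and p: "p \<in> piece G (ini G (w n))"
      and xy: "x \<in> cylinder G w n" "y \<in> cylinder G w n"
    have v: "ini G (w n) \<in> verts G" using inf_words_ini_verts[OF w] .
    have "conformal_at (prefix_map G w n) p"
      using prefix_map_conformal_at[OF w] piece_subset_W[OF v] p by blast
    then have pos: "0 \<le> deriv_norm (prefix_map G w n) p" by (simp add: conformal_at_def)
    have "dist x y \<le> M (ini G (w n)) * deriv_norm (prefix_map G w n) p"
      using M(2)[OF v w p xy] .
    also have "\<dots> \<le> (1 + sum M (verts G)) * deriv_norm (prefix_map G w n) p"
      using member_le_sum[OF v, of M] M(1) finite_verts pos by (intro mult_right_mono) fastforce+
    finally show "dist x y \<le> (1 + sum M (verts G)) * deriv_norm (prefix_map G w n) p" .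
  qed
qed

section \<open>Inner balls of pieces and stopping cylinders\<close>

text \<open>A ball of radius equal to the separation misses the frontier of the total space, so by
  connectedness it stays inside. The pieces are closed and disjoint, so connectedness also confines
  it to the piece of its centre.\<close>

lemma piece_inner_ball:
  assumes "0 < setdist (frontier (total_space G)) (limit_set G)"
  shows "\<exists>\<delta>>0. \<forall>v\<in>verts G. \<forall>q\<in>piece G v \<inter> limit_set G. ball q \<delta> \<subseteq> interior (piece G v)"
proof (intro exI conjI ballI)
  let ?\<delta> = "setdist (frontier (total_space G)) (limit_set G)"
  show "0 < ?\<delta>" by fact
  fix v q assume v: "v \<in> verts G" and q: "q \<in> piece G v \<inter> limit_set G"
  have "z \<notin> frontier (total_space G)" if "z \<in> ball q ?\<delta>" for z
    using setdist_le_dist[of z "frontier (total_space G)" q "limit_set G"] q that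
    by (auto simp: dist_commute)
  then have "ball q ?\<delta> \<inter> frontier (total_space G) = {}" by blast
  moreover have "q \<in> ball q ?\<delta> \<inter> total_space G"
    using assms q v by (auto simp: total_space_def)
  ultimately have sub: "ball q ?\<delta> \<subseteq> total_space G"
    using connected_Int_frontier[OF connected_ball] by blast
  define Y where "Y = (\<Union>u\<in>verts G - {v}. piece G u)"
  have "closed (piece G v)" "closed Y"
    using piece_compact v finite_verts by (auto simp: Y_def compact_imp_closed)
  moreover have "piece G v \<inter> Y = {}"
  proof -
    have "piece G v \<inter> piece G u = {}" if "u \<in> verts G" "u \<noteq> v" for u
      using S_disjoint v that piece_subset_S' unfolding disjoint_family_on_def by blast
    then show ?thesis by (auto simp: Y_def)
  qed
  moreover have "ball q ?\<delta> \<subseteq> piece G v \<union> Y"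
    using sub v by (auto simp: total_space_def Y_def)
  moreover have "piece G v \<inter> ball q ?\<delta> \<noteq> {}" using q assms by auto
  ultimately have "Y \<inter> ball q ?\<delta> = {}"
    using connected_ball[of q ?\<delta>] unfolding connected_closed by blast
  then have "ball q ?\<delta> \<subseteq> piece G v"
    using \<open>ball q ?\<delta> \<subseteq> piece G v \<union> Y\<close> by blast
  then show "ball q ?\<delta> \<subseteq> interior (piece G v)"
    by (simp add: interior_maximal)
qed

text \<open>The parent cylinder is still larger than \<open>r\<close>, so its derivative is at least
  \<open>r / M\<close>. The last letter costs at most a factor \<open>d\<close>, and distortion
  carries the bound to a whole ball around \<open>q\<close>, whose image contains a proportionally
  large ball.\<close>

lemma stopping_cylinder_inner_ball:
  assumes fin: "finite (edges G)"
    and sep: "0 < setdist (frontier (total_space G)) (limit_set G)"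
  shows "\<exists>c>0. \<forall>w\<in>inf_words G. \<forall>r n. 0 < r \<and> r \<le> 1 \<and> stops_at G w r n \<longrightarrow>
    ball (coding_map G w) (c * r) \<subseteq> open_cylinder G w n"
proof -
  obtain K where K: "1 \<le> K"
    and dist: "\<And>w n p q. \<lbrakk>w \<in> inf_words G; p \<in> S (ini G (w n)); q \<in> S (ini G (w n))\<rbrakk> \<Longrightarrow>
      deriv_norm (prefix_map G w n) p \<le> K * deriv_norm (prefix_map G w n) q"
    using distortion by blast
  obtain d where d: "0 < d"
    "\<And>e p. e \<in> edges G \<Longrightarrow> p \<in> piece G (ter G e) \<Longrightarrow> d \<le> deriv_norm (phi G e) p"
    using phi_deriv_lower_bound[OF fin] by blast
  obtain M where M: "1 \<le> M" "\<And>w n p x y. \<lbrakk>w \<in> inf_words G; p \<in> piece G (ini G (w n));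
      x \<in> cylinder G w n; y \<in> cylinder G w n\<rbrakk> \<Longrightarrow> dist x y \<le> M * deriv_norm (prefix_map G w n) p"
    using cylinder_diameter_bound by blast
  obtain \<delta> where \<delta>: "0 < \<delta>"
    "\<And>v q. v \<in> verts G \<Longrightarrow> q \<in> piece G v \<inter> limit_set G \<Longrightarrow> ball q \<delta> \<subseteq> interior (piece G v)"
    using piece_inner_ball[OF sep] by blast
  show ?thesis
  \<comment> \<open>\<open>d / (M * K) * r\<close> will bound the derivative from below on
    \<open>ball q \<delta>\<close>; multiplied by \<open>\<delta>\<close>, it is the radius of a
    ball inside the image.\<close>
  proof (intro exI[of _ "d / (M * K) * \<delta>"] conjI ballI allI impI)
    show "0 < d / (M * K) * \<delta>" using d(1) M(1) K \<delta>(1) by simp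
    fix w r n
    assume w: "w \<in> inf_words G" and *: "0 < r \<and> r \<le> 1 \<and> stops_at G w r n"
    then obtain m where m: "n = Suc m" by (cases n) (auto simp: stops_at_def)
    let ?f = "prefix_map G w n"
    define q where "q = coding_map G (\<lambda>k. w (n + k))"
    have w': "(\<lambda>k. w (n + k)) \<in> inf_words G" using shift_inf_words[OF w] .
    have v: "ini G (w n) \<in> verts G" using inf_words_ini_verts[OF w] .
    have q: "q \<in> piece G (ini G (w n))" "q \<in> limit_set G"
      using coding_map_in_cylinder[OF w', of 0] w' by (auto simp: q_def limit_set_def)
    have fq: "coding_map G w = ?f q" using coding_map_shift[OF w] by (simp add: q_def)
    have e: "w m \<in> edges G" and ter: "ter G (w m) = ini G (w n)"
      using inf_words_edges[OF w] inf_words_ter[OF w] m by auto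
    have \<phi>q: "phi G (w m) q \<in> piece G (ini G (w m))"
      using phi_into[OF e] q ter by auto
    let ?a = "deriv_norm (prefix_map G w m) (phi G (w m) q)"
    \<comment> \<open>For a one-letter word the parent map is the identity with derivative norm 1,
      and \<open>r \<le> 1 \<le> M\<close> replaces the diameter comparison.\<close>
    have ra: "r \<le> M * ?a"
    proof (cases "m = 0")
      case True
      then show ?thesis using * M(1) by (simp add: deriv_norm_id)
    next
      case False
      then obtain x y where "x \<in> cylinder G w m" "y \<in> cylinder G w m" "r < dist x y"
        using * m unfolding stops_at_def by (metis One_nat_def Suc_leI lessI not_gr_zero)
      then show ?thesis using M(2)[OF w \<phi>q] by force
    qed
    have f_conf: "conformal_at ?f p" if "p \<in> W (ini G (w n))" for p
      using prefix_map_conformal_at[OF w that] .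
    have qW: "q \<in> W (ini G (w n))" using q piece_subset_W[OF v] by blast
    have "deriv_norm ?f q = ?a * deriv_norm (phi G (w m)) q"
      using prefix_map_Suc_conformal(2)[OF w prefix_map_conformal_at[OF w]] qW m by simp
    moreover have "d \<le> deriv_norm (phi G (w m)) q" using d(2)[OF e] q ter by simp
    moreover have "0 \<le> ?a" using ra * M(1) by (smt (verit) mult_less_0_iff)
    ultimately have "?a * d \<le> deriv_norm ?f q" by (simp add: mult_left_mono)
    moreover have "r * d \<le> M * (?a * d)" using mult_right_mono[OF ra, of d] d(1) by simp
    ultimately have "r * d \<le> M * deriv_norm ?f q"
      using M(1) by (smt (verit) mult_left_mono)
    then have low_q: "d / M * r \<le> deriv_norm ?f q"
      using M(1) by (simp add: field_simps)
    have sub: "ball q \<delta> \<subseteq> interior (piece G (ini G (w n)))" using \<delta>(2)[OF v] q by blast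
    have subS: "ball q \<delta> \<subseteq> S (ini G (w n))"
      using sub interior_subset piece_subset_S'[OF v] by blast
    have subW: "ball q \<delta> \<subseteq> W (ini G (w n))" using subS S_subset_W[OF v] by blast
    have "ball (?f q) (d / (M * K) * r * \<delta>) \<subseteq> ?f ` ball q \<delta>"
    proof (rule ball_subset_image_ball)
      show "inj_on ?f (ball q \<delta>)"
        using prefix_map_inj_on[OF w, of W n] phi_W phi_inj_W subW inj_on_subset by metis
      show "0 < d / (M * K) * r" using d(1) M(1) K * by simp
      fix p assume p: "p \<in> ball q \<delta>"
      have "deriv_norm ?f q \<le> K * deriv_norm ?f p"
        using dist[OF w] q p subS piece_subset_S'[OF v] by blast
      then have "d / M * r \<le> K * deriv_norm ?f p" using low_q by simp
      then have low: "d / (M * K) * r \<le> deriv_norm ?f p"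
        using K M(1) by (simp add: field_simps)
      obtain D where D: "(?f has_derivative D) (at p)" "\<And>h. norm (D h) = deriv_norm ?f p * norm h"
        using f_conf[of p] p subW unfolding conformal_at_def by blast
      have "\<forall>h. d / (M * K) * r * norm h \<le> norm (D h)"
        unfolding D(2) using mult_right_mono[OF low norm_ge_zero] by blast
      then show "\<exists>D. (?f has_derivative D) (at p) \<and> (\<forall>h. d / (M * K) * r * norm h \<le> norm (D h))"
        using D(1) by blast
    qed (use \<delta>(1) in simp)
    also have "\<dots> \<subseteq> open_cylinder G w n" using sub by (rule image_mono)
    finally show "ball (coding_map G w) (d / (M * K) * \<delta> * r) \<subseteq> open_cylinder G w n"
      by (simp add: fq mult_ac)
  qed
qed

end

section \<open>Directed porosity of the limit set\<close>

text \<open>A ball inside \<open>ball x r\<close> has radius at most \<open>r\<close>, so the set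
  under the supremum is bounded above by 1 and each of its members is a lower bound for the
  supremum.\<close>

lemma le_por_dir:
  fixes x :: "'a :: euclidean_space"
  assumes "0 < r" "0 \<le> c" "y \<in> (+) x ` span {v}" "ball y (c * r) \<subseteq> ball x r - U"
  shows "c \<le> por_dir v U x r"
  unfolding por_dir_def
proof (rule cSup_upper)
  have "c \<le> 1" if "0 \<le> c" "ball y (c * r) \<subseteq> ball x r" for c y
  proof (rule ccontr)
    assume "\<not> c \<le> 1"
    then have "r < c * r" using \<open>0 < r\<close> by simp
    moreover have "dist y x + c * r \<le> r \<or> c * r \<le> 0"
      using that(2) by (simp add: ball_subset_ball_iff)
    moreover have "0 \<le> dist y x" by simp
    ultimately show False using \<open>0 < r\<close> by linarith
  qed
  then show "bdd_above {c. 0 \<le> c \<and> (\<exists>y. y \<in> (+) x ` span {v} \<and> ball y (c * r) \<subseteq> ball x r - U)}"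
    by (intro bdd_aboveI[of _ 1]) blast
qed (use assms in blast)

theorem theorem1p3:
  fixes G :: "('v, 'e, real ^ 'n) gdms_data"
    and W S :: "'v \<Rightarrow> (real ^ 'n) set"
  assumes "conformal_gdms G W S"
    and "finite_gdms G"
    and "irreducible_gdms G"
    and "setdist (frontier (total_space G)) (limit_set G) > 0"
  shows "\<forall>v\<in>sphere 0 1. directed_porous v (limit_set G)"
proof
  fix v :: "real ^ 'n" assume "v \<in> sphere 0 1"
  then have "v \<noteq> 0" by auto
  interpret conformal_gdms G W S by fact
  obtain c where c: "0 < c"
    "\<And>w r n. \<lbrakk>w \<in> inf_words G; 0 < r; r \<le> 1; stops_at G w r n\<rbrakk> \<Longrightarrow>
       ball (coding_map G w) (c * r) \<subseteq> open_cylinder G w n"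
    using stopping_cylinder_inner_ball assms(2,4) unfolding finite_gdms_def by blast
  \<comment> \<open>\<open>c / 2\<close> comes from inner balls of radius
    \<open>c * (r / 2)\<close>; \<open>1 / 2\<close> keeps the ball around \<open>z\<close> inside
    \<open>ball x r\<close>.\<close>
  define c' where "c' = min (c / 2) (1 / 2)"
  show "directed_porous v (limit_set G)"
    unfolding directed_porous_def
  proof (rule exI[of _ c'], rule exI[of _ 1], intro conjI ballI allI impI)
    show "0 < c'" "c' < 1" "0 < (1 :: real)" using c(1) by (auto simp: c'_def)
    fix x r assume "x \<in> limit_set G" and r: "0 < r \<and> r < (1 :: real)"
    then obtain w where w: "w \<in> inf_words G" and x: "x = coding_map G w"
      by (auto simp: limit_set_def)
    \<comment> \<open>Stopping at scale \<open>r / 2\<close> puts the cylinder of \<open>x\<close>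
      within \<open>cball x (r / 2)\<close> and leaves room for a ball around its boundary
      point.\<close>
    have r2: "0 < r / 2" "r / 2 \<le> 1" using r by auto
    obtain n where n: "stops_at G w (r / 2) n" using ex_stops_at[OF w r2(1)] by blast
    define U where "U = open_cylinder G w n"
    have "open U" using open_open_cylinder[OF w] by (simp add: U_def)
    have xU: "x \<in> U" using c(2)[OF w r2 n] c(1) r by (force simp: U_def x)
    have "U \<subseteq> cylinder G w n"
      unfolding U_def by (intro image_mono interior_subset)
    moreover have "dist a b \<le> r / 2" if "a \<in> cylinder G w n" "b \<in> cylinder G w n" for a b
      using n that unfolding stops_at_def by blast
    ultimately have "U \<subseteq> cball x (r / 2)"
      using xU unfolding mem_cball subset_iff by blast
    then have clU: "closure U \<subseteq> cball x (r / 2)" by (simp add: closure_minimal)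
    then have "bounded U"
      by (intro bounded_subset[OF bounded_cball order_trans[OF closure_subset]])
    moreover have "x \<in> interior U" using xU \<open>open U\<close> by (simp add: interior_open)
    ultimately obtain t where t: "x + t *\<^sub>R v \<in> frontier U"
      using ray_to_frontier[of U x v] \<open>v \<noteq> 0\<close> by blast
    define z where "z = x + t *\<^sub>R v"
    have z: "z \<in> closure U" "z \<notin> U"
      using t \<open>open U\<close> by (auto simp: z_def frontier_def interior_open)
    have far: "c' * r \<le> dist z p" if pJ: "p \<in> limit_set G" for p
    proof -
      obtain u where u: "u \<in> inf_words G" and p: "p = coding_map G u"
        using pJ by (auto simp: limit_set_def)
      obtain k where k: "stops_at G u (r / 2) k" using ex_stops_at[OF u r2(1)] by blast
      \<comment> \<open>An open set disjoint from \<open>U\<close> also misses its closure. Since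
        \<open>z\<close> lies in the closure of \<open>U\<close> but not in \<open>U\<close>, both
        alternatives exclude it from the open cylinder of \<open>p\<close>.\<close>
      have "U = open_cylinder G u k \<or> open_cylinder G u k \<inter> closure U = {}"
        unfolding open_Int_closure_eq_empty[OF open_open_cylinder[OF u]]
        using stopping_cylinders_eq_or_disjoint[OF w u n k] unfolding U_def by blast
      then have "z \<notin> open_cylinder G u k" using z by blast
      then have "z \<notin> ball p (c * (r / 2))" using c(2)[OF u r2 k] p by blast
      then have "c / 2 * r \<le> dist z p" by (simp add: dist_commute)
      moreover have "c' * r \<le> c / 2 * r" using r by (intro mult_right_mono) (auto simp: c'_def)
      ultimately show ?thesis by linarith
    qed
    have "dist x z \<le> r / 2" using z clU by auto
    moreover have "c' * r \<le> r / 2" using r by (simp add: c'_def min_def)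
    ultimately have "ball z (c' * r) \<subseteq> ball x r"
      by (simp add: ball_subset_ball_iff dist_commute)
    then have "ball z (c' * r) \<subseteq> ball x r - limit_set G" using far by fastforce
    moreover have "z \<in> (+) x ` span {v}" by (auto simp: z_def span_singleton)
    ultimately show "c' \<le> por_dir v (limit_set G) x r"
      using r \<open>0 < c'\<close> by (intro le_por_dir[of r c' z]) simp_all
  qed
qed

end
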